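(* Let $A\in\mathbb{R}^{n\times n}$ be an invertible symmetric matrix with distinct eigenvalues $a_1,\dots,a_p$, and let $b\in\mathbb{R}^n$. Consider GMRES(1) applied to $Ax=b$, and let $\varrho^*_{GMRES(1)}$ be its worst-case root-convergence factor. If $A$ is definite, then $$\varrho^*_{GMRES(1)}=\max_{i\neq j,\; i,j\in\{1,\dots,p\}}\frac{|a_j-a_i|}{|a_j|+|a_i|}=\left|\frac{\lambda_{\max}(A)-\lambda_{\min}(A)}{\lambda_{\max}(A)+\lambda_{\min}(A)}\right|,$$ and if $A$ is indefinite, then $\varrho^*_{GMRES(1)}=1$.
   Context: $\langle\cdot,\cdot\rangle$ and $\|\cdot\|$ are the Euclidean inner product and norm. For $v\neq 0$ put $\alpha(v)=\frac{\langle v,Av\rangle}{\langle Av,Av\rangle}$. GMRES(1) (minimal residual iteration) for $Ax=b$: given $x_0\in\mathbb{R}^n$, set $r_0=Ax_0-b$ and, for $k=0,1,2,\dots$, $x_{k+1}=x_k-\alpha(r_k)r_k$ and $r_{k+1}=r_k-\alpha(r_k)Ar_k$; if $r_k=0$ the iteration stops and one sets $r_m=0$ for all $m\ge k$. The root-convergence factor for a given initial residual is $\varrho(r_0)=\limsup_{k\to\infty}\|r_k\|^{1/k}$, and the worst-case root-convergence factor is the maximum of $\varrho(r_0)$ over all initial guesses $x_0\in\mathbb{R}^n$. "Definite" means positive definite or negative definite; "indefinite" means having both positive and negative eigenvalues. $\lambda_{\max}(A),\lambda_{\min}(A)$ are the largest and smallest eigenvalues. A maximum over an empty index set (case $p=1$)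 is taken to be $0$. *)

theory Defs
  imports "HOL-Analysis.Analysis"
begin

definition eigenvalues :: "real^'n^'n \<Rightarrow> real set" where
  "eigenvalues A = {c. \<exists>v. v \<noteq> 0 \<and> A *v v = c *\<^sub>R v}"

definition pos_definite :: "real^'n^'n \<Rightarrow> bool" where
  "pos_definite A \<longleftrightarrow> (\<forall>v. v \<noteq> 0 \<longrightarrow> v \<bullet> (A *v v) > 0)"

definition neg_definite :: "real^'n^'n \<Rightarrow> bool" where
  "neg_definite A \<longleftrightarrow> (\<forall>v. v \<noteq> 0 \<longrightarrow> v \<bullet> (A *v v) < 0)"

definition definite :: "real^'n^'n \<Rightarrow> bool" where
  "definite A \<longleftrightarrow> pos_definite A \<or> neg_definite A"

definition indefinite :: "real^'n^'n \<Rightarrow> bool" where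
  "indefinite A \<longleftrightarrow> (\<exists>c\<in>eigenvalues A. c > 0) \<and> (\<exists>c\<in>eigenvalues A. c < 0)"

definition max_or_zero :: "real set \<Rightarrow> real" where
  "max_or_zero S = (if S = {} then 0 else Max S)"

definition gmres1_alpha :: "real^'n^'n \<Rightarrow> real^'n \<Rightarrow> real" where
  "gmres1_alpha A v = (v \<bullet> (A *v v)) / ((A *v v) \<bullet> (A *v v))"

text \<open>The pair of iterate and residual after \<open>k\<close> steps. Residuals have the sign convention
  \<open>A x - b\<close>; after a zero residual the iteration is stationary.\<close>

primrec gmres1 :: "real^'n^'n \<Rightarrow> real^'n \<Rightarrow> real^'n \<Rightarrow> nat \<Rightarrow> (real^'n) \<times> (real^'n)" where
  "gmres1 A b x0 0 = (x0, A *v x0 - b)"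
| "gmres1 A b x0 (Suc k) =
     (let (x, r) = gmres1 A b x0 k in
      if r = 0 then (x, 0)
      else (x - gmres1_alpha A r *\<^sub>R r, r - gmres1_alpha A r *\<^sub>R (A *v r)))"

definition gmres1_residual :: "real^'n^'n \<Rightarrow> real^'n \<Rightarrow> real^'n \<Rightarrow> nat \<Rightarrow> real^'n" where
  "gmres1_residual A b x0 k = snd (gmres1 A b x0 k)"

text \<open>The upper limit is taken in the extended reals, so that it exists unconditionally. The
  term for \<open>k = 0\<close>, where \<open>root 0\<close> is constantly \<open>0\<close>, does not affect it.\<close>

definition root_conv_factor :: "real^'n^'n \<Rightarrow> real^'n \<Rightarrow> real^'n \<Rightarrow> ereal" where
  "root_conv_factor A b x0 =
     limsup (\<lambda>k. ereal (root k (norm (gmres1_residual A b x0 k))))"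

text \<open>A relation rather than a function: it includes the claim that the maximum over all
  initial guesses is attained.\<close>

definition is_worst_case_factor :: "real^'n^'n \<Rightarrow> real^'n \<Rightarrow> real \<Rightarrow> bool" where
  "is_worst_case_factor A b \<rho> \<longleftrightarrow>
     (\<exists>x0. root_conv_factor A b x0 = ereal \<rho>) \<and>
     (\<forall>x0. root_conv_factor A b x0 \<le> ereal \<rho>)"

end

theory Submission imports Defs
begin

text \<open>
  One step replaces the residual \<open>r\<close> by the shortest vector on the line \<open>r - t A r\<close>, so every fixed
  \<open>t\<close> gives an upper bound. Let \<open>m\<close> and \<open>M\<close> be the extreme eigenvalues and suppose that they have the
  same sign. The operator \<open>(M - A)(A - m)\<close> has only nonnegative eigenvalues, so its quadratic form is
  nonnegative (\<open>selfadjoint_norm_image_le\<close>); with \<open>t = 2 / (m + M)\<close> this bounds the reduction of the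
  residual in each step by \<open>\<rho> = \<bar>(M - m) / (M + m)\<bar>\<close> (\<open>minimal_residual_contraction\<close>).

  The bound is attained in every step at once. For orthonormal eigenvectors \<open>u\<close>, \<open>v\<close> belonging to
  \<open>m\<close>, \<open>M\<close>, the vectors \<open>x u + y v\<close> with \<open>m x\<^sup>2 = M y\<^sup>2\<close> are those whose optimal \<open>t\<close> is
  \<open>2 / (m + M)\<close>. The step maps such a vector to \<open>(M - m) / (M + m)\<close> times \<open>x u - y v\<close>, which is again
  of this kind, so all residuals of the iteration shrink by exactly \<open>\<rho>\<close>
  (\<open>residual_two_eigenvectors\<close>). That \<open>\<rho>\<close> is the largest of the quotients
  \<open>\<bar>y - x\<bar> / (\<bar>y\<bar> + \<bar>x\<bar>)\<close> over pairs of eigenvalues holds because the quotient grows when two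
  numbers of the same sign move apart (\<open>max_pair_quotient\<close>).

  For indefinite \<open>A\<close> residuals still never grow, so the factor is at most \<open>1\<close>. Two eigenvectors with
  eigenvalues of opposite sign combine to some \<open>r \<noteq> 0\<close> with \<open>\<langle>r, A r\<rangle> = 0\<close>; then the step length is
  \<open>0\<close> and the iteration stagnates.
\<close>

section \<open>Quadratic forms of self-adjoint operators\<close>

text \<open>Minimise the Rayleigh quotient over the unit sphere of \<open>S\<close>. At the minimiser the first variation
  in the direction \<open>f v - c v\<close>, which lies in \<open>S\<close> by invariance, must vanish; it is twice the
  squared norm of that vector. The general \<open>S\<close> allows eigenspaces of an operator commuting with \<open>f\<close>.\<close>

lemma selfadjoint_min_eigenvector:
  fixes f :: "'a::euclidean_space \<Rightarrow> 'a"
  assumes lin: "linear f" and sa: "\<And>x y. x \<bullet> f y = f x \<bullet> y"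
    and S: "subspace S" "u \<in> S" "u \<noteq> 0" and inv: "\<And>x. x \<in> S \<Longrightarrow> f x \<in> S"
  obtains v c where "v \<in> S" "v \<noteq> 0" "f v = c *\<^sub>R v" "\<And>w. w \<in> S \<Longrightarrow> c * (w \<bullet> w) \<le> w \<bullet> f w"
proof -
  interpret f: linear f by (rule lin)
  let ?K = "S \<inter> sphere 0 1"
  have "compact ?K" using closed_subspace[OF S(1)] by (simp add: closed_Int_compact)
  moreover have "u /\<^sub>R norm u \<in> ?K" using S by (simp add: subspace_scale)
  then have "?K \<noteq> {}" by blast
  moreover have "continuous_on ?K (\<lambda>w. w \<bullet> f w)"
    by (intro continuous_intros linear_continuous_on linear_linear[THEN iffD2] lin)
  ultimately obtain v where v: "v \<in> ?K" and min: "\<And>w. w \<in> ?K \<Longrightarrow> v \<bullet> f v \<le> w \<bullet> f w"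
    using continuous_attains_inf by metis
  define c where "c = v \<bullet> f v"
  have vv: "v \<bullet> v = 1" and vS: "v \<in> S" and v0: "v \<noteq> 0" using v by (auto simp: dot_square_norm)
  have ray: "c * (w \<bullet> w) \<le> w \<bullet> f w" if "w \<in> S" for w
  proof (cases "w = 0")
    case False
    have "w /\<^sub>R norm w \<in> ?K" using that S False by (simp add: subspace_scale)
    from min[OF this] show ?thesis using False
      by (simp add: c_def f.scaleR divide_simps dot_square_norm power2_eq_square mult.assoc)
  qed simp
  define g where "g = f v - c *\<^sub>R v"
  have gS: "g \<in> S" unfolding g_def by (intro subspace_diff subspace_scale S inv vS)
  define G where "G = g \<bullet> g"
  define Q where "Q = g \<bullet> f g - c * (g \<bullet> g)"
  have Q: "0 \<le> Q" using ray[OF gS] by (simp add: Q_def)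
  have var: "0 \<le> 2 * t * G + t\<^sup>2 * Q" for t
  proof -
    have "v + t *\<^sub>R g \<in> S" by (intro subspace_add subspace_scale S vS gS)
    from ray[OF this] have "0 \<le> (v + t *\<^sub>R g) \<bullet> f (v + t *\<^sub>R g) - c * ((v + t *\<^sub>R g) \<bullet> (v + t *\<^sub>R g))"
      by (simp only: diff_ge_0_iff_ge)
    also have "\<dots> = (v \<bullet> f v - c * (v \<bullet> v)) + t * (v \<bullet> f g + g \<bullet> f v - 2 * c * (g \<bullet> v)) + t\<^sup>2 * Q"
      by (simp add: Q_def f.add f.scaleR inner_add_left inner_add_right power2_eq_square
          inner_commute[of v g] algebra_simps)
    also have "v \<bullet> f g = g \<bullet> f v" using sa[of v g] by (simp add: inner_commute)
    also have "g \<bullet> f v + g \<bullet> f v - 2 * c * (g \<bullet> v) = 2 * G"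
      by (simp add: G_def g_def inner_diff_right algebra_simps)
    finally show ?thesis by (simp add: c_def vv)
  qed
  have "G = 0"
  proof (rule ccontr)
    assume "G \<noteq> 0"
    \<comment> \<open>The parabola \<open>2 t G + t\<^sup>2 Q\<close> is negative for small \<open>t < 0\<close>. Its vertex is \<open>- G / Q\<close>;
      \<open>Q + 1\<close> covers \<open>Q = 0\<close> as well.\<close>
    have "2 * (- G / (Q + 1)) * G + (- G / (Q + 1))\<^sup>2 * Q = - (G\<^sup>2 * (Q + 2)) / (Q + 1)\<^sup>2"
      using Q by (simp add: divide_simps power2_eq_square) (simp add: algebra_simps)
    also have "\<dots> < 0" using Q \<open>G \<noteq> 0\<close> by (intro divide_neg_pos) auto
    finally show False using var[of "- G / (Q + 1)"] by linarith
  qed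
  then have "f v = c *\<^sub>R v" by (simp add: G_def g_def)
  then show ?thesis using that vS v0 ray by blast
qed

text \<open>The form of \<open>h = (M - f)(f - m)\<close> is bounded below by the least eigenvalue \<open>\<beta>\<close> of \<open>h\<close>. The
  \<open>\<beta>\<close>-eigenspace of \<open>h\<close> is invariant under \<open>f\<close>, so it contains an eigenvector of \<open>f\<close>, with eigenvalue
  \<open>c\<close> say; hence \<open>\<beta> = (M - c)(c - m) \<ge> 0\<close>. This replaces an orthonormal eigenbasis.\<close>

lemma selfadjoint_norm_image_le:
  fixes f :: "'a::euclidean_space \<Rightarrow> 'a"
  assumes lin: "linear f" and sa: "\<And>x y. x \<bullet> f y = f x \<bullet> y"
    and eig: "\<And>w c. w \<noteq> 0 \<Longrightarrow> f w = c *\<^sub>R w \<Longrightarrow> m \<le> c \<and> c \<le> M"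
  shows "f v \<bullet> f v \<le> (M + m) * (v \<bullet> f v) - m * M * (v \<bullet> v)"
proof (cases "v = 0")
  case True
  then show ?thesis using linear_0[OF lin] by simp
next
  case False
  interpret f: linear f by (rule lin)
  define h where "h x = (M + m) *\<^sub>R f x - f (f x) - (m * M) *\<^sub>R x" for x
  have linh: "linear h"
    by (rule linearI) (simp_all add: h_def f.add f.scaleR algebra_simps)
  have sah: "x \<bullet> h y = h x \<bullet> y" for x y
    by (simp add: h_def inner_diff_left inner_diff_right sa)
  obtain w \<beta> where w: "w \<noteq> 0" "h w = \<beta> *\<^sub>R w" and ray: "\<And>x. \<beta> * (x \<bullet> x) \<le> x \<bullet> h x"
    using selfadjoint_min_eigenvector[OF linh sah subspace_UNIV UNIV_I False] by auto
  let ?S = "{x. h x = \<beta> *\<^sub>R x}"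
  have subsp: "subspace ?S"
    using linear_0[OF linh] linear_add[OF linh] linear_scale[OF linh]
    by (auto simp: subspace_def scaleR_add_right)
  have inv: "f x \<in> ?S" if "x \<in> ?S" for x
  proof -
    have "h (f x) = f (h x)" by (simp add: h_def f.diff f.scaleR)
    with that show ?thesis by (simp add: f.scaleR)
  qed
  have "w \<in> ?S" using w(2) by simp
  from selfadjoint_min_eigenvector[OF lin sa subsp this w(1) inv]
  obtain z c where z: "z \<in> ?S" "z \<noteq> 0" "f z = c *\<^sub>R z" by blast
  have "\<beta> *\<^sub>R z = ((M - c) * (c - m)) *\<^sub>R z"
    using z(1) by (simp add: h_def z(3) f.scaleR algebra_simps)
  then have "\<beta> = (M - c) * (c - m)" using z(2) by simp
  then have "0 \<le> \<beta>" using eig[OF z(2,3)] by simp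
  then have "0 \<le> v \<bullet> h v" using ray[of v] by (meson inner_ge_zero mult_nonneg_nonneg order_trans)
  also have "v \<bullet> h v = (M + m) * (v \<bullet> f v) - f v \<bullet> f v - m * M * (v \<bullet> v)"
    by (simp add: h_def inner_diff_right sa)
  finally show ?thesis by simp
qed

lemma symmetric_matrix_selfadjoint:
  fixes A :: "real^'n^'n"
  assumes "transpose A = A"
  shows "x \<bullet> (A *v y) = (A *v x) \<bullet> y"
  using dot_lmul_matrix[of x A y] assms by (metis transpose_matrix_vector)

lemma eigenvalues_nonempty:
  fixes A :: "real^'n^'n"
  assumes "transpose A = A"
  shows "eigenvalues A \<noteq> {}"
proof -
  obtain u :: "real^'n" where "u \<noteq> 0" using axis_eq_0_iff zero_neq_one by blast
  from selfadjoint_min_eigenvector[OF matrix_vector_mul_linear[of A]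
      symmetric_matrix_selfadjoint[OF assms] subspace_UNIV UNIV_I this UNIV_I]
  obtain v c where "v \<noteq> 0" "A *v v = c *\<^sub>R v" by metis
  then show ?thesis unfolding eigenvalues_def by blast
qed

lemma eigenvector_unit:
  assumes "c \<in> eigenvalues A"
  obtains v where "v \<bullet> v = 1" "A *v v = c *\<^sub>R v"
proof -
  from assms obtain w where "w \<noteq> 0" "A *v w = c *\<^sub>R w" by (auto simp: eigenvalues_def)
  then have "(w /\<^sub>R norm w) \<bullet> (w /\<^sub>R norm w) = 1" "A *v (w /\<^sub>R norm w) = c *\<^sub>R (w /\<^sub>R norm w)"
    by (simp_all add: dot_square_norm power2_eq_square matrix_vector_mult_scaleR)
  then show ?thesis by (rule that)
qed

lemma eigenvectors_orthogonal:
  fixes A :: "real^'n^'n"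
  assumes "transpose A = A" "A *v u = c *\<^sub>R u" "A *v v = d *\<^sub>R v" "c \<noteq> d"
  shows "u \<bullet> v = 0"
proof -
  have "c * (u \<bullet> v) = d * (u \<bullet> v)"
    using symmetric_matrix_selfadjoint[OF assms(1), of u v] assms(2,3)
    by (simp only: inner_scaleR_left inner_scaleR_right)
  then show ?thesis using assms(4) by simp
qed

lemma definite_eigenvalues_same_sign:
  assumes "definite A" "x \<in> eigenvalues A" "y \<in> eigenvalues A"
  shows "0 < x * y"
proof -
  obtain u v where u: "u \<bullet> u = 1" "A *v u = x *\<^sub>R u" and v: "v \<bullet> v = 1" "A *v v = y *\<^sub>R v"
    using assms(2,3) by (metis eigenvector_unit)
  then have "u \<noteq> 0" "v \<noteq> 0" "u \<bullet> (A *v u) = x" "v \<bullet> (A *v v) = y" by auto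
  then have "(0 < x \<and> 0 < y) \<or> (x < 0 \<and> y < 0)"
    using assms(1) unfolding definite_def pos_definite_def neg_definite_def by metis
  then show ?thesis by (auto simp: mult_neg_neg)
qed

section \<open>One step of the iteration\<close>

lemma gmres1_residual_0: "gmres1_residual A b x0 0 = A *v x0 - b"
  by (simp add: gmres1_residual_def)

lemma gmres1_residual_Suc:
  "gmres1_residual A b x0 (Suc k) = gmres1_residual A b x0 k
     - gmres1_alpha A (gmres1_residual A b x0 k) *\<^sub>R (A *v gmres1_residual A b x0 k)"
  by (simp add: gmres1_residual_def Let_def case_prod_unfold)

lemma initial_residual_surj:
  fixes A :: "real^'n^'n"
  assumes "invertible A"
  obtains x0 where "gmres1_residual A b x0 0 = r"
proof -
  obtain B where "A ** B = mat 1" using assms by (auto simp: invertible_def)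
  then have "A *v (B *v (r + b)) - b = r"
    by (simp add: matrix_vector_mul_assoc)
  then show ?thesis using that gmres1_residual_0 by metis
qed

text \<open>The step length is the coefficient of the orthogonal projection of \<open>r\<close> onto the line of
  \<open>A r\<close>. If \<open>A r = 0\<close>, both sides are the norm of \<open>r\<close>.\<close>

lemma gmres1_step_minimal:
  fixes A :: "real^'n^'n"
  shows "norm (r - gmres1_alpha A r *\<^sub>R (A *v r)) \<le> norm (r - t *\<^sub>R (A *v r))"
proof (cases "A *v r = 0")
  case False
  define w where "w = A *v r"
  define s where "s = gmres1_alpha A r"
  have proj: "r \<bullet> w = s * (w \<bullet> w)" using False by (simp add: s_def w_def gmres1_alpha_def)
  have "(r - t *\<^sub>R w) \<bullet> (r - t *\<^sub>R w)
      = (r - s *\<^sub>R w) \<bullet> (r - s *\<^sub>R w) + (t - s)\<^sup>2 * (w \<bullet> w)"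
    unfolding inner_diff_left inner_diff_right inner_scaleR_left inner_scaleR_right
      inner_commute[of w r] proj by (simp add: power2_eq_square algebra_simps)
  then have "(r - s *\<^sub>R w) \<bullet> (r - s *\<^sub>R w) \<le> (r - t *\<^sub>R w) \<bullet> (r - t *\<^sub>R w)" by simp
  then show ?thesis by (simp add: norm_le s_def w_def)
qed simp

text \<open>The choice \<open>t = 2 / (M + m)\<close> is the one for which \<open>1 - t c\<close> has equal modulus at both ends
  \<open>c = m\<close> and \<open>c = M\<close> of the spectrum.\<close>

lemma minimal_residual_contraction:
  fixes A :: "real^'n^'n"
  assumes sym: "transpose A = A" and eig: "\<And>c. c \<in> eigenvalues A \<Longrightarrow> m \<le> c \<and> c \<le> M"
    and mM: "M + m \<noteq> 0"
  shows "norm (r - gmres1_alpha A r *\<^sub>R (A *v r)) \<le> \<bar>(M - m) / (M + m)\<bar> * norm r"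
proof -
  define t where "t = 2 / (M + m)"
  have bound: "(A *v r) \<bullet> (A *v r) \<le> (M + m) * (r \<bullet> (A *v r)) - m * M * (r \<bullet> r)"
    by (rule selfadjoint_norm_image_le[OF matrix_vector_mul_linear
          symmetric_matrix_selfadjoint[OF sym]])
       (use eig in \<open>auto simp: eigenvalues_def\<close>)
  have "(r - t *\<^sub>R (A *v r)) \<bullet> (r - t *\<^sub>R (A *v r))
      = r \<bullet> r - 2 * t * (r \<bullet> (A *v r)) + t\<^sup>2 * ((A *v r) \<bullet> (A *v r))"
    by (simp add: inner_diff_left inner_diff_right inner_commute power2_eq_square)
  also have "\<dots> \<le> r \<bullet> r - 2 * t * (r \<bullet> (A *v r))
      + t\<^sup>2 * ((M + m) * (r \<bullet> (A *v r)) - m * M * (r \<bullet> r))"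
    using bound by (intro add_left_mono mult_left_mono) auto
  also have "\<dots> = ((M - m) / (M + m))\<^sup>2 * (r \<bullet> r)"
    using mM by (simp add: t_def divide_simps power2_eq_square) algebra
  finally have "(norm (r - t *\<^sub>R (A *v r)))\<^sup>2 \<le> (\<bar>(M - m) / (M + m)\<bar> * norm r)\<^sup>2"
    by (simp only: dot_square_norm power_mult_distrib power2_abs)
  then have "norm (r - t *\<^sub>R (A *v r)) \<le> \<bar>(M - m) / (M + m)\<bar> * norm r"
    by (rule power2_le_imp_le) (intro mult_nonneg_nonneg abs_ge_zero norm_ge_zero)
  then show ?thesis using gmres1_step_minimal order_trans by blast
qed

section \<open>Root-convergence factors\<close>

lemma limsup_root_geometric:
  assumes "0 < c" "0 \<le> \<rho>"
  shows "limsup (\<lambda>k. ereal (root k (c * \<rho> ^ k))) = ereal \<rho>"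
proof -
  have "(\<lambda>k. root k c * \<rho>) \<longlonglongrightarrow> 1 * \<rho>"
    by (intro tendsto_mult LIMSEQ_root_const assms tendsto_const)
  moreover have "\<forall>\<^sub>F k in sequentially. root k c * \<rho> = root k (c * \<rho> ^ k)"
    using eventually_gt_at_top[of 0]
    by eventually_elim (simp add: real_root_mult real_root_power_cancel assms)
  ultimately have "(\<lambda>k. root k (c * \<rho> ^ k)) \<longlonglongrightarrow> \<rho>"
    using Lim_transform_eventually by force
  then show ?thesis by (intro lim_imp_Limsup) auto
qed

lemma root_conv_factor_nonneg: "0 \<le> root_conv_factor A b x0"
proof -
  have "limsup (\<lambda>k::nat. (0::ereal)) \<le> root_conv_factor A b x0"
    unfolding root_conv_factor_def by (rule Limsup_mono) (simp add: real_root_ge_zero)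
  then show ?thesis by (simp add: Limsup_const)
qed

lemma root_conv_factor_le:
  assumes "0 \<le> \<rho>"
    and step: "\<And>k. norm (gmres1_residual A b x0 (Suc k)) \<le> \<rho> * norm (gmres1_residual A b x0 k)"
  shows "root_conv_factor A b x0 \<le> ereal \<rho>"
proof -
  let ?n = "\<lambda>k. norm (gmres1_residual A b x0 k)"
  \<comment> \<open>The summand \<open>1\<close> keeps the constant positive when the initial residual vanishes.\<close>
  have bound: "?n k \<le> (?n 0 + 1) * \<rho> ^ k" for k
  proof (induction k)
    case (Suc k)
    have "?n (Suc k) \<le> \<rho> * ?n k" by (rule step)
    also have "\<dots> \<le> \<rho> * ((?n 0 + 1) * \<rho> ^ k)" using Suc assms(1) by (rule mult_left_mono)
    finally show ?case by (simp add: mult_ac)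
  qed simp
  have "root_conv_factor A b x0 \<le> limsup (\<lambda>k. ereal (root k ((?n 0 + 1) * \<rho> ^ k)))"
    unfolding root_conv_factor_def
  proof (intro Limsup_mono always_eventually allI)
    show "ereal (root k (?n k)) \<le> ereal (root k ((?n 0 + 1) * \<rho> ^ k))" for k
      by (cases "k = 0") (auto intro: real_root_le_mono bound)
  qed
  also have "\<dots> = ereal \<rho>" by (rule limsup_root_geometric) (auto simp: assms add_nonneg_pos)
  finally show ?thesis .
qed

lemma root_conv_factor_geometric:
  assumes "0 < c" "0 \<le> \<rho>" "\<And>k. norm (gmres1_residual A b x0 k) = c * \<rho> ^ k"
  shows "root_conv_factor A b x0 = ereal \<rho>"
  using limsup_root_geometric[OF assms(1,2)] by (simp add: root_conv_factor_def assms(3))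

section \<open>Initial residuals in the span of two eigenvectors\<close>

text \<open>Under \<open>m x\<^sup>2 = M y\<^sup>2\<close> the step length is \<open>2 / (M + m)\<close>, and the two components are multiplied by
  the opposite factors \<open>\<plusminus>(M - m) / (M + m)\<close>.\<close>

lemma gmres1_step_two_eigenvectors:
  fixes A :: "real^'n^'n"
  assumes u: "u \<bullet> u = 1" "A *v u = m *\<^sub>R u" and v: "v \<bullet> v = 1" "A *v v = M *\<^sub>R v"
    and uv: "u \<bullet> v = 0" and mM: "M + m \<noteq> 0" "m \<noteq> 0" "x \<noteq> 0" and xy: "m * x\<^sup>2 = M * y\<^sup>2"
    and r: "r = x *\<^sub>R u + y *\<^sub>R v"
  shows "r - gmres1_alpha A r *\<^sub>R (A *v r) = ((M - m) / (M + m)) *\<^sub>R (x *\<^sub>R u - y *\<^sub>R v)"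
proof -
  have Ar: "A *v r = (x * m) *\<^sub>R u + (y * M) *\<^sub>R v"
    by (simp add: r matrix_vector_right_distrib matrix_vector_mult_scaleR u v)
  have vu: "v \<bullet> u = 0" using uv by (simp add: inner_commute)
  have n: "r \<bullet> (A *v r) = m * x\<^sup>2 + M * y\<^sup>2"
    unfolding Ar unfolding r by (simp add: inner_add_left inner_add_right u v uv vu power2_eq_square)
  have d: "(A *v r) \<bullet> (A *v r) = m * (m * x\<^sup>2) + M * (M * y\<^sup>2)"
    unfolding Ar by (simp add: inner_add_left inner_add_right u v uv vu power2_eq_square)
  have "gmres1_alpha A r = 2 * (m * x\<^sup>2) / ((M + m) * (m * x\<^sup>2))"
    unfolding gmres1_alpha_def n d xy[symmetric] by (simp add: algebra_simps)
  also have "\<dots> = 2 / (M + m)" using mM by simp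
  finally have alpha: "gmres1_alpha A r = 2 / (M + m)" .
  have "r - gmres1_alpha A r *\<^sub>R (A *v r)
      = (x * (1 - 2 / (M + m) * m)) *\<^sub>R u + (y * (1 - 2 / (M + m) * M)) *\<^sub>R v"
    unfolding alpha Ar unfolding r by (simp add: algebra_simps)
  also have "1 - 2 / (M + m) * m = (M - m) / (M + m)" using mM(1) by (simp add: field_simps)
  also have "1 - 2 / (M + m) * M = - ((M - m) / (M + m))" using mM(1) by (simp add: field_simps)
  finally show ?thesis by (simp add: scaleR_diff_right mult.commute)
qed

text \<open>The condition \<open>m x\<^sup>2 = M y\<^sup>2\<close> does not see the sign of \<open>y\<close> or a common scaling of \<open>x\<close> and \<open>y\<close>, so
  it is inherited by the next residual.\<close>

lemma residual_two_eigenvectors: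
  fixes A :: "real^'n^'n"
  assumes u: "u \<bullet> u = 1" "A *v u = m *\<^sub>R u" and v: "v \<bullet> v = 1" "A *v v = M *\<^sub>R v"
    and uv: "u \<bullet> v = 0" and mM: "M + m \<noteq> 0" "m \<noteq> 0" "M \<noteq> m" "x \<noteq> 0" and xy: "m * x\<^sup>2 = M * y\<^sup>2"
    and r0: "gmres1_residual A b x0 0 = x *\<^sub>R u + y *\<^sub>R v"
  shows "norm (gmres1_residual A b x0 k) = sqrt (x\<^sup>2 + y\<^sup>2) * \<bar>(M - m) / (M + m)\<bar> ^ k"
proof -
  define q where "q = (M - m) / (M + m)"
  have q0: "q \<noteq> 0" using mM by (simp add: q_def)
  have form: "gmres1_residual A b x0 k = (q ^ k * x) *\<^sub>R u + (q ^ k * (- 1) ^ k * y) *\<^sub>R v"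
  proof (induction k)
    case (Suc k)
    have "m * (q ^ k * x)\<^sup>2 = M * (q ^ k * (- 1) ^ k * y)\<^sup>2"
      using xy by (simp add: power_mult_distrib flip: power_mult)
    from gmres1_step_two_eigenvectors[OF u v uv mM(1,2) _ this Suc]
    show ?case unfolding gmres1_residual_Suc
      using q0 mM by (simp add: q_def[symmetric] scaleR_diff_right mult.assoc)
  qed (simp add: r0)
  have vu: "v \<bullet> u = 0" using uv by (simp add: inner_commute)
  have "gmres1_residual A b x0 k \<bullet> gmres1_residual A b x0 k = (x\<^sup>2 + y\<^sup>2) * (\<bar>q\<bar> ^ k)\<^sup>2"
    unfolding form
    by (simp add: inner_add_left inner_add_right u v uv vu power2_eq_square algebra_simps
        flip: power_mult_distrib)
  then show ?thesis by (simp add: norm_eq_sqrt_inner real_sqrt_mult q_def)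
qed

text \<open>Orthonormal eigenvectors for eigenvalues \<open>c > 0 > d\<close>, weighted by \<open>sqrt (- d)\<close> and \<open>sqrt c\<close>,
  contribute \<open>- c d\<close> and \<open>c d\<close> to the quadratic form. The step length at such a vector is \<open>0\<close>.\<close>

lemma indefinite_isotropic_vector:
  fixes A :: "real^'n^'n"
  assumes sym: "transpose A = A" and "indefinite A"
  obtains r where "r \<noteq> 0" "r \<bullet> (A *v r) = 0"
proof -
  obtain c d where cd: "c \<in> eigenvalues A" "0 < c" "d \<in> eigenvalues A" "d < 0"
    using assms(2) by (auto simp: indefinite_def)
  obtain u where u: "u \<bullet> u = 1" "A *v u = c *\<^sub>R u" using eigenvector_unit cd(1) by metis
  obtain v where v: "v \<bullet> v = 1" "A *v v = d *\<^sub>R v" using eigenvector_unit cd(3) by metis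
  have uv: "u \<bullet> v = 0" using eigenvectors_orthogonal[OF sym u(2) v(2)] cd by simp
  have vu: "v \<bullet> u = 0" using uv by (simp add: inner_commute)
  define r where "r = sqrt (- d) *\<^sub>R u + sqrt c *\<^sub>R v"
  have "A *v r = (sqrt (- d) * c) *\<^sub>R u + (sqrt c * d) *\<^sub>R v"
    by (simp add: r_def matrix_vector_right_distrib matrix_vector_mult_scaleR u v)
  then have "r \<bullet> (A *v r) = (sqrt (- d))\<^sup>2 * c + (sqrt c)\<^sup>2 * d"
    unfolding r_def
    by (simp only: inner_add_left inner_add_right inner_scaleR_left inner_scaleR_right u v uv vu
        power2_eq_square) (simp only: mult_1_left mult_zero_left mult_1_right mult_zero_right
        add_0_left add_0_right mult_ac)
  then have "r \<bullet> (A *v r) = 0" using cd by simp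
  moreover have "r \<bullet> u = sqrt (- d)" by (simp add: r_def inner_add_left u vu)
  then have "r \<noteq> 0" using cd by auto
  ultimately show ?thesis using that by blast
qed

section \<open>The extremal pair of eigenvalues\<close>

lemma pair_quotient_le:
  fixes x y m M :: real
  assumes "m \<le> x" "x \<le> M" "m \<le> y" "y \<le> M" "0 < m * M"
  shows "\<bar>y - x\<bar> / (\<bar>y\<bar> + \<bar>x\<bar>) \<le> \<bar>(M - m) / (M + m)\<bar>"
proof -
  have pos: "\<bar>y - x\<bar> / (\<bar>y\<bar> + \<bar>x\<bar>) \<le> \<bar>(M - m) / (M + m)\<bar>"
    if "0 < m" "m \<le> x" "x \<le> y" "y \<le> M" for x y m M :: real
  proof -
    have "y * m \<le> M * x" using that by (intro mult_mono) auto
    then have "(y - x) / (y + x) \<le> (M - m) / (M + m)"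
      using that by (simp add: divide_simps algebra_simps)
    then show ?thesis using that by simp
  qed
  from assms(5) consider "0 < m" "0 < M" | "m < 0" "M < 0" by (auto simp: zero_less_mult_iff)
  then show ?thesis
  proof cases
    case 1
    then show ?thesis
      using pos[of m x y M] pos[of m y x M] assms by (cases "x \<le> y") (auto simp: abs_minus_commute add.commute)
  next
    case 2
    have "\<bar>(- m - - M) / (- m + - M)\<bar> = \<bar>(M - m) / (M + m)\<bar>"
      by (simp add: abs_divide) (simp add: abs_if)
    then show ?thesis
      using pos[of "- M" "- x" "- y" "- m"] pos[of "- M" "- y" "- x" "- m"] 2 assms
      by (cases "x \<le> y") (auto simp: abs_minus_commute add.commute)
  qed
qed

lemma max_pair_quotient:
  fixes E :: "real set"
  assumes fin: "finite E" and ne: "E \<noteq> {}" and sgn: "\<And>x y. x \<in> E \<Longrightarrow> y \<in> E \<Longrightarrow> 0 < x * y"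
  shows "max_or_zero {\<bar>y - x\<bar> / (\<bar>y\<bar> + \<bar>x\<bar>) | x y. x \<in> E \<and> y \<in> E \<and> x \<noteq> y}
    = \<bar>(Max E - Min E) / (Max E + Min E)\<bar>" (is "max_or_zero ?Q = ?\<rho>")
proof -
  have mem: "Min E \<in> E" "Max E \<in> E" using fin ne by auto
  have le: "Min E \<le> x \<and> x \<le> Max E" if "x \<in> E" for x using fin that by auto
  show ?thesis
  proof (cases "Min E = Max E")
    case True
    then have "?Q = {}" using le by (auto intro: order_antisym order_trans)
    then show ?thesis using True by (simp add: max_or_zero_def)
  next
    case False
    have "?Q \<subseteq> (\<lambda>(x, y). \<bar>y - x\<bar> / (\<bar>y\<bar> + \<bar>x\<bar>)) ` (E \<times> E)" by auto
    then have "finite ?Q" using fin by (meson finite_SigmaI finite_imageI finite_subset)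
    moreover have "\<bar>Max E\<bar> + \<bar>Min E\<bar> = \<bar>Max E + Min E\<bar>"
      using sgn[OF mem] by (auto simp: zero_less_mult_iff)
    then have "?\<rho> \<in> ?Q"
      using mem le[OF mem(1)] False
      by (intro CollectI exI[of _ "Min E"] exI[of _ "Max E"]) (simp add: abs_divide)
    moreover have "q \<le> ?\<rho>" if "q \<in> ?Q" for q
      using that pair_quotient_le[OF _ _ _ _ sgn[OF mem]] le by blast
    ultimately have "Max ?Q = ?\<rho>" and "?Q \<noteq> {}" by (blast intro: Max_eqI)+
    then show ?thesis unfolding max_or_zero_def by (simp only: if_False)
  qed
qed

section \<open>Worst-case factors\<close>

lemma definite_worst_case_factor:
  fixes A :: "real^'n^'n"
  assumes inv: "invertible A" and sym: "transpose A = A" and "definite A"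
    and fin: "finite (eigenvalues A)"
  defines "m \<equiv> Min (eigenvalues A)" and "M \<equiv> Max (eigenvalues A)"
  shows "is_worst_case_factor A b \<bar>(M - m) / (M + m)\<bar>" (is "is_worst_case_factor A b ?\<rho>")
proof -
  have ne: "eigenvalues A \<noteq> {}" by (rule eigenvalues_nonempty[OF sym])
  have mem: "m \<in> eigenvalues A" "M \<in> eigenvalues A" using fin ne by (auto simp: m_def M_def)
  have le: "m \<le> c \<and> c \<le> M" if "c \<in> eigenvalues A" for c
    using fin that by (auto simp: m_def M_def)
  have mM: "0 < m * M" using definite_eigenvalues_same_sign[OF assms(3) mem] .
  then have s0: "M + m \<noteq> 0" "m \<noteq> 0" "M \<noteq> 0" by (auto simp: zero_less_mult_iff)
  have upper: "root_conv_factor A b x0 \<le> ereal ?\<rho>" for x0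
    by (rule root_conv_factor_le)
       (auto simp only: gmres1_residual_Suc abs_ge_zero
          intro: minimal_residual_contraction[OF sym le s0(1)])
  have "\<exists>x0. root_conv_factor A b x0 = ereal ?\<rho>"
  proof (cases "M = m")
    case True
    \<comment> \<open>Here \<open>\<rho> = 0\<close>, and every initial guess attains it.\<close>
    then have "root_conv_factor A b 0 = ereal ?\<rho>"
      using upper[of 0] root_conv_factor_nonneg[of A b 0] by (simp add: zero_ereal_def[symmetric])
    then show ?thesis by blast
  next
    case False
    obtain u where u: "u \<bullet> u = 1" "A *v u = m *\<^sub>R u" using eigenvector_unit mem(1) by metis
    obtain v where v: "v \<bullet> v = 1" "A *v v = M *\<^sub>R v" using eigenvector_unit mem(2) by metis
    have uv: "u \<bullet> v = 0" using eigenvectors_orthogonal[OF sym u(2) v(2)] False by simp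
    \<comment> \<open>As \<open>m\<close> and \<open>M\<close> have the same sign, these weights balance \<open>m x\<^sup>2 = M y\<^sup>2\<close>.\<close>
    let ?x = "sqrt \<bar>M\<bar>" and ?y = "sqrt \<bar>m\<bar>"
    obtain x0 where x0: "gmres1_residual A b x0 0 = ?x *\<^sub>R u + ?y *\<^sub>R v"
      using initial_residual_surj[OF inv] by metis
    have xy: "m * ?x\<^sup>2 = M * ?y\<^sup>2" using mM by (auto simp: zero_less_mult_iff)
    have x_ne: "?x \<noteq> 0" using s0 by simp
    have "root_conv_factor A b x0 = ereal ?\<rho>"
      by (rule root_conv_factor_geometric[OF _ _
            residual_two_eigenvectors[OF u v uv s0(1,2) False x_ne xy x0]])
         (use s0 in \<open>auto simp: add_pos_pos\<close>)
    then show ?thesis by blast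
  qed
  with upper show ?thesis by (simp add: is_worst_case_factor_def)
qed

lemma indefinite_worst_case_factor:
  fixes A :: "real^'n^'n"
  assumes inv: "invertible A" and sym: "transpose A = A" and "indefinite A"
  shows "is_worst_case_factor A b 1"
proof -
  have upper: "root_conv_factor A b x0 \<le> ereal 1" for x0
  proof (rule root_conv_factor_le)
    \<comment> \<open>Compare the optimal step with the step of length \<open>0\<close>.\<close>
    show "norm (gmres1_residual A b x0 (Suc k)) \<le> 1 * norm (gmres1_residual A b x0 k)" for k
      using gmres1_step_minimal[of "gmres1_residual A b x0 k" A 0] by (simp add: gmres1_residual_Suc)
  qed simp
  obtain r where r: "r \<noteq> 0" "r \<bullet> (A *v r) = 0"
    using indefinite_isotropic_vector[OF sym assms(3)] by metis
  obtain x0 where x0: "gmres1_residual A b x0 0 = r" using initial_residual_surj[OF inv] by metis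
  have "gmres1_residual A b x0 k = r" for k
    by (induction k) (simp_all add: x0 gmres1_residual_Suc gmres1_alpha_def r)
  then have "root_conv_factor A b x0 = ereal 1"
    by (intro root_conv_factor_geometric[of "norm r"]) (simp_all add: r)
  with upper show ?thesis by (auto simp: is_worst_case_factor_def)
qed

theorem theorem2p15:
  fixes A :: "real^'n^'n" and b :: "real^'n" and a :: "nat \<Rightarrow> real" and p :: nat
  assumes "invertible A"
    and "transpose A = A"
    and "bij_betw a {1..p} (eigenvalues A)"
  shows "(definite A \<longrightarrow>
            is_worst_case_factor A b
              (max_or_zero {\<bar>a j - a i\<bar> / (\<bar>a j\<bar> + \<bar>a i\<bar>) | i j.
                 i \<in> {1..p} \<and> j \<in> {1..p} \<and> i \<noteq> j}) \<and>
            max_or_zero {\<bar>a j - a i\<bar> / (\<bar>a j\<bar> + \<bar>a i\<bar>) | i j.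
                 i \<in> {1..p} \<and> j \<in> {1..p} \<and> i \<noteq> j}
              = \<bar>(Max (eigenvalues A) - Min (eigenvalues A)) /
                 (Max (eigenvalues A) + Min (eigenvalues A))\<bar>) \<and>
         (indefinite A \<longrightarrow> is_worst_case_factor A b 1)"
proof -
  have img: "eigenvalues A = a ` {1..p}" and inj: "inj_on a {1..p}"
    using assms(3) by (auto simp: bij_betw_def)
  have fin: "finite (eigenvalues A)" by (simp add: img)
  have pairs: "{\<bar>a j - a i\<bar> / (\<bar>a j\<bar> + \<bar>a i\<bar>) | i j. i \<in> {1..p} \<and> j \<in> {1..p} \<and> i \<noteq> j}
      = {\<bar>y - x\<bar> / (\<bar>y\<bar> + \<bar>x\<bar>) | x y. x \<in> eigenvalues A \<and> y \<in> eigenvalues A \<and> x \<noteq> y}"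
    unfolding img using inj_on_eq_iff[OF inj] by blast
  show ?thesis
    unfolding pairs
  proof (intro conjI impI)
    assume "definite A"
    from definite_eigenvalues_same_sign[OF this]
    show max: "max_or_zero {\<bar>y - x\<bar> / (\<bar>y\<bar> + \<bar>x\<bar>) | x y.
          x \<in> eigenvalues A \<and> y \<in> eigenvalues A \<and> x \<noteq> y}
        = \<bar>(Max (eigenvalues A) - Min (eigenvalues A)) /
           (Max (eigenvalues A) + Min (eigenvalues A))\<bar>"
      by (rule max_pair_quotient[OF fin eigenvalues_nonempty[OF assms(2)]])
    show "is_worst_case_factor A b (max_or_zero {\<bar>y - x\<bar> / (\<bar>y\<bar> + \<bar>x\<bar>) | x y.
          x \<in> eigenvalues A \<and> y \<in> eigenvalues A \<and> x \<noteq> y})"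
      unfolding max by (rule definite_worst_case_factor[OF assms(1,2) \<open>definite A\<close> fin])
  next
    assume "indefinite A"
    then show "is_worst_case_factor A b 1"
      by (rule indefinite_worst_case_factor[OF assms(1,2)])
  qed
qed

end
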